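(* Let $f:Q\to\mathbb{R}$ be a convex continuous function, let $x^*\in Q$ be an optimal solution of $\min_{x\in Q} f(x)$, and let $R>0$ be such that $V_\psi(x^*,x)\le R$ for all $x\in Q$. Fix $a\in[0,1]$, $m\ge -1$ and an integer $N\ge 1$. Let $x^1\in Q$ and let $x^2,\ldots,x^{N+1}$ be generated by the mirror descent method $$x^{k+1}=\arg\min_{x\in Q}\left\{\langle x,\nabla f(x^k)\rangle+\frac{1}{\gamma_k}V_\psi(x,x^k)\right\},\qquad \nabla f(x^k)\in\partial f(x^k),\qquad k=1,\ldots,N,$$ with the positive non-increasing step sizes $$\gamma_k=\frac{\sqrt{2\sigma R}}{G_k\,k^{a/2}},\qquad k=1,\ldots,N,$$ where $$G_k=\max\left\{G_{k-1},\ \|\nabla f(x^k)\|_*\,k^{\frac{1-a}{2}}\right\},\qquad G_0:=-\infty.$$ Define the weights $$\omega_k^{(m)}=\begin{cases}1/\gamma_k^m, & \text{if } -1\le m\le 0,\\ k^{m/2}, & \text{if } m>0,\end{cases}\qquad k=1,\ldots,N,$$ and $$\widehat{x}=\frac{1}{\sum_{k=1}^N\omega_k^{(m)}}\sum_{k=1}^N\omega_k^{(m)}x^k.$$ Then $$f(\widehat{x})-f(x^* )\le\sqrt{\frac{R}{2\sigma}}\cdot\frac{N^{\frac{m+1}{2}}+\sum_{k=1}^N k^{\frac{m-1}{2}}}{\sum_{k=1}^N k^{\frac{m}{2}}}\cdot\max_{k=1,\ldots,N}\|\nabla f(x^k)\|_*.$$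
   Context: $(\mathbf{E},\|\cdot\|)$ is a normed finite-dimensional real vector space with an arbitrary norm, $\mathbf{E}^*$ is its conjugate (dual) space with norm $\|y\|_*=\max\{\langle y,x\rangle:\ x\in\mathbf{E},\ \|x\|\le 1\}$, where $\langle y,x\rangle$ is the value of $y\in\mathbf{E}^*$ at $x\in\mathbf{E}$. $Q\subset\mathbf{E}$ is a compact convex set. $\psi:Q\to\mathbb{R}$ is a proper closed differentiable function that is $\sigma$-strongly convex with respect to $\|\cdot\|$, with $\sigma>0$ (the prox-function). Its Bregman divergence is $V_\psi(x,y)=\psi(x)-\psi(y)-\langle\nabla\psi(y),x-y\rangle$ for $x,y\in Q$; it satisfies $V_\psi(x,y)\ge\frac{\sigma}{2}\|x-y\|^2$. $\partial f(x)$ denotes the subdifferential of $f$ at $x$, i.e. the set of $g\in\mathbf{E}^*$ with $f(y)\ge f(x)+\langle g,y-x\rangle$ for all $y\in Q$, and $\nabla f(x)$ denotes a chosen element of $\partial f(x)$; the method presupposes that a subgradient is available at each iterate $x^1,\ldots,x^N$. No Lipschitz continuity of $f$ and no a priori bound on the subgradients is assumed. Positivity (well-definedness) of the step sizes means $G_k>0$ for all $k$, i.e. $\nabla f(x^1)\ne 0$. *)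

theory Defs
  imports "HOL-Analysis.Analysis"
begin

text \<open>
  The space is a type \<open>'a :: real_normed_vector\<close> (so the norm is arbitrary); its dual is
  \<open>'a \<Rightarrow>\<^sub>L real\<close>, whose library norm is the dual norm:
\<close>

lemma norm_dual_eq_SUP:
  fixes y :: "'a::real_normed_vector \<Rightarrow>\<^sub>L real"
  shows "norm y = (SUP x\<in>{x. norm x \<le> 1}. blinfun_apply y x)"
proof (rule antisym)
  have le: "blinfun_apply y x \<le> norm y" if "norm x \<le> 1" for x
  proof -
    have "blinfun_apply y x \<le> norm y * norm x"
      using norm_blinfun[of y x] by simp
    also have "\<dots> \<le> norm y"
      using that by (simp add: mult_left_le)
    finally show ?thesis .
  qed
  have bdd: "bdd_above (blinfun_apply y ` {x. norm x \<le> 1})"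
    using le by (auto intro!: bdd_aboveI2)
  let ?S = "SUP x\<in>{x. norm x \<le> 1}. blinfun_apply y x"
  have up: "blinfun_apply y x \<le> ?S" if "norm x \<le> 1" for x
    using that by (intro cSUP_upper[OF _ bdd]) simp
  show "?S \<le> norm y"
  proof (rule cSUP_least)
    show "{x::'a. norm x \<le> 1} \<noteq> {}"
      by (auto intro!: exI[of _ 0])
  qed (use le in simp)
  show "norm y \<le> ?S"
  proof (rule norm_blinfun_bound)
    show "0 \<le> ?S"
      using up[of 0] by simp
    fix x :: 'a
    show "norm (blinfun_apply y x) \<le> ?S * norm x"
    proof (cases "x = 0")
      case False
      have "blinfun_apply y (inverse (norm x) *\<^sub>R x) \<le> ?S"
           "blinfun_apply y (inverse (norm x) *\<^sub>R - x) \<le> ?S"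
        using False by (intro up; simp)+
      then have "\<bar>blinfun_apply y x\<bar> / norm x \<le> ?S"
        by (simp only: blinfun.scaleR_right blinfun.minus_right)
           (auto simp: abs_if field_simps)
      then show ?thesis
        using False by (simp add: field_simps)
    qed simp
  qed
qed

definition strongly_convex_on ::
    "real \<Rightarrow> 'a::real_normed_vector set \<Rightarrow> ('a \<Rightarrow> real) \<Rightarrow> bool" where
  "strongly_convex_on \<sigma> Q \<psi> \<longleftrightarrow> convex Q \<and>
     (\<forall>x\<in>Q. \<forall>y\<in>Q. \<forall>t\<in>{0..1}.
        \<psi> (t *\<^sub>R x + (1 - t) *\<^sub>R y)
          \<le> t * \<psi> x + (1 - t) * \<psi> y - \<sigma> / 2 * t * (1 - t) * (norm (x - y))\<^sup>2)"

text \<open>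
  \<open>\<psi>'\<close> is a gradient map of \<open>\<psi>\<close>. As \<open>\<psi>\<close> lives on \<open>Q\<close> only, differentiability is
  relative to \<open>Q\<close>. If \<open>Q\<close> has empty interior, \<open>\<psi>' y\<close> need not be unique, but its values on
  \<open>x - y\<close> with \<open>x, y \<in> Q\<close> are, and nothing else enters the Bregman divergence.
  Since \<open>\<psi>\<close> is real-valued on \<open>Q\<close>, it is proper iff \<open>Q\<close> is nonempty.
\<close>

definition prox_function ::
    "real \<Rightarrow> 'a::real_normed_vector set \<Rightarrow> ('a \<Rightarrow> real) \<Rightarrow> ('a \<Rightarrow> 'a \<Rightarrow>\<^sub>L real) \<Rightarrow> bool" where
  "prox_function \<sigma> Q \<psi> \<psi>' \<longleftrightarrow>
     Q \<noteq> {} \<and> closed (epigraph Q \<psi>) \<and>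
     (\<forall>y\<in>Q. (\<psi> has_derivative blinfun_apply (\<psi>' y)) (at y within Q)) \<and>
     \<sigma> > 0 \<and> strongly_convex_on \<sigma> Q \<psi>"

definition bregman ::
    "('a::real_normed_vector \<Rightarrow> real) \<Rightarrow> ('a \<Rightarrow> 'a \<Rightarrow>\<^sub>L real) \<Rightarrow> 'a \<Rightarrow> 'a \<Rightarrow> real" where
  "bregman \<psi> \<psi>' x y = \<psi> x - \<psi> y - blinfun_apply (\<psi>' y) (x - y)"

definition subdifferential ::
    "'a::real_normed_vector set \<Rightarrow> ('a \<Rightarrow> real) \<Rightarrow> 'a \<Rightarrow> ('a \<Rightarrow>\<^sub>L real) set" where
  "subdifferential Q f x = {g. \<forall>y\<in>Q. f y \<ge> f x + blinfun_apply g (y - x)}"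

text \<open>In the following, \<open>g k\<close> is the subgradient chosen at the \<open>k\<close>-th iterate, \<open>k \<ge> 1\<close>.\<close>

primrec md_G :: "real \<Rightarrow> (nat \<Rightarrow> 'a::real_normed_vector \<Rightarrow>\<^sub>L real) \<Rightarrow> nat \<Rightarrow> ereal" where
  "md_G a g 0 = -\<infinity>"
| "md_G a g (Suc k) =
     max (md_G a g k) (ereal (norm (g (Suc k)) * real (Suc k) powr ((1 - a) / 2)))"

definition md_step ::
    "real \<Rightarrow> real \<Rightarrow> real \<Rightarrow> (nat \<Rightarrow> 'a::real_normed_vector \<Rightarrow>\<^sub>L real) \<Rightarrow> nat \<Rightarrow> real" where
  "md_step \<sigma> R a g k =
     sqrt (2 * \<sigma> * R) / (real_of_ereal (md_G a g k) * real k powr (a / 2))"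

definition md_weight :: "real \<Rightarrow> (nat \<Rightarrow> real) \<Rightarrow> nat \<Rightarrow> real" where
  "md_weight m \<gamma> k = (if m \<le> 0 then 1 / (\<gamma> k powr m) else real k powr (m / 2))"

end

theory Submission
  imports Defs
begin

text \<open>
  One mirror step satisfies the usual inequality
  \<open>f (x k) - f xstar \<le> \<gamma> k * (norm (g k))\<^sup>2 / (2 * \<sigma>) + (V k - V (k + 1)) / \<gamma> k\<close> with
  \<open>V k = bregman \<psi> \<psi>' xstar (x k)\<close>. Write \<open>\<gamma> k = c / H k\<close> with \<open>c = sqrt (2 * \<sigma> * R)\<close>. The weights are
  chosen such that \<open>\<omega> k * H k\<close> is nondecreasing, so the weighted sum of the differences telescopes
  to at most \<open>R * \<omega> N / \<gamma> N\<close>. The step sizes are chosen such that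
  \<open>norm (g k) * sqrt k \<le> H k \<le> M * sqrt k\<close>, where \<open>M\<close> is the largest subgradient norm. Up to a
  common factor \<open>p\<close>, the weights are therefore at least \<open>k powr (m / 2)\<close>, while the error terms
  \<open>\<omega> k * (norm (g k))\<^sup>2 / H k \<le> \<omega> k * H k / k\<close> are at most \<open>M * k powr ((m - 1) / 2)\<close>.
\<close>

section \<open>The inequality for one mirror step and its summation\<close>

lemma has_derivative_within_convex_le:
  fixes \<phi> :: "'a::real_normed_vector \<Rightarrow> real"
  assumes der: "(\<phi> has_derivative D) (at x within Q)"
    and Q: "convex Q" "x \<in> Q" "y \<in> Q"
    and le: "\<And>t. 0 < t \<Longrightarrow> t < 1 \<Longrightarrow> \<phi> (x + t *\<^sub>R (y - x)) - \<phi> x \<le> t * (A + B * t)"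
  shows "D (y - x) \<le> A"
proof -
  \<comment> \<open>Derivatives exist only relative to \<open>Q\<close>, so everything is pulled
    back to the segment from \<open>x\<close> to \<open>y\<close>. There a one-sided difference
    quotient is at most \<open>A + B * t\<close>, and the term \<open>B * t\<close> dies in the
    limit.\<close>
  let ?l = "\<lambda>t::real. x + t *\<^sub>R (y - x)"
  have img: "?l ` {0..1} \<subseteq> Q"
  proof clarify
    fix t :: real assume "t \<in> {0..1}"
    then have "(1 - t) *\<^sub>R x + t *\<^sub>R y \<in> Q"
      using Q by (intro convexD) auto
    then show "?l t \<in> Q" by (simp add: algebra_simps)
  qed
  have "(?l has_derivative (\<lambda>t. t *\<^sub>R (y - x))) (at 0 within {0..1})"
    by (auto intro!: derivative_eq_intros)
  moreover have "(\<phi> has_derivative D) (at (?l 0) within ?l ` {0..1})"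
    using has_derivative_subset[OF der img] by simp
  ultimately have "((\<lambda>t. \<phi> (?l t)) has_derivative (\<lambda>t. D (t *\<^sub>R (y - x)))) (at 0 within {0..1})"
    by (rule has_derivative_in_compose)
  moreover have "D (t *\<^sub>R (y - x)) = D (y - x) * t" for t
    using linear_cmul[OF has_derivative_linear[OF der]] by simp
  ultimately have "((\<lambda>t. \<phi> (?l t)) has_real_derivative D (y - x)) (at 0 within {0..1})"
    by (simp add: has_field_derivative_def)
  then have "((\<lambda>t. (\<phi> (?l t) - \<phi> x) / t) \<longlongrightarrow> D (y - x)) (at 0 within {0..1})"
    by (simp add: has_field_derivative_iff)
  then have lim: "((\<lambda>t. (\<phi> (?l t) - \<phi> x) / t) \<longlongrightarrow> D (y - x)) (at_right 0)"
    by (simp add: at_within_Icc_at_right)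
  have limr: "((\<lambda>t. A + B * t) \<longlongrightarrow> A + B * 0) (at_right 0)"
    by (intro tendsto_intros)
  have "\<forall>\<^sub>F t in at_right (0::real). (\<phi> (?l t) - \<phi> x) / t \<le> A + B * t"
    using eventually_at_right_real[OF zero_less_one]
    by eventually_elim (use le in \<open>auto simp: divide_le_eq mult.commute\<close>)
  from tendsto_le[OF _ limr lim this] show ?thesis by simp
qed

text \<open>Strong convexity on the segment gives a difference quotient with error factor
  \<open>1 - t\<close>. Its \<open>t\<close>-part goes into \<open>B\<close>, which vanishes in the
  limit, so the full quadratic term survives in \<open>A\<close>.\<close>

lemma bregman_ge:
  assumes "prox_function \<sigma> Q \<psi> \<psi>'" "x \<in> Q" "y \<in> Q"
  shows "\<sigma> / 2 * (norm (y - x))\<^sup>2 \<le> bregman \<psi> \<psi>' y x"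
proof -
  let ?n = "\<sigma> / 2 * (norm (y - x))\<^sup>2"
  have "blinfun_apply (\<psi>' x) (y - x) \<le> \<psi> y - \<psi> x - ?n"
  proof (rule has_derivative_within_convex_le)
    show "(\<psi> has_derivative blinfun_apply (\<psi>' x)) (at x within Q)" "convex Q"
      using assms by (auto simp: prox_function_def strongly_convex_on_def)
    fix t :: real assume "0 < t" "t < 1"
    then have "\<psi> (t *\<^sub>R y + (1 - t) *\<^sub>R x)
        \<le> t * \<psi> y + (1 - t) * \<psi> x - \<sigma> / 2 * t * (1 - t) * (norm (y - x))\<^sup>2"
      using assms by (auto simp: prox_function_def strongly_convex_on_def)
    moreover have "t *\<^sub>R y + (1 - t) *\<^sub>R x = x + t *\<^sub>R (y - x)"
      by (simp add: algebra_simps)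
    ultimately show "\<psi> (x + t *\<^sub>R (y - x)) - \<psi> x \<le> t * ((\<psi> y - \<psi> x - ?n) + ?n * t)"
      by (simp add: field_simps)
  qed (use assms in auto)
  then show ?thesis by (simp add: bregman_def)
qed

text \<open>Minimality of \<open>z\<close> along the segment to \<open>u\<close> gives the
  variational inequality for the gradient of the objective at \<open>z\<close>. The difference of
  \<open>\<psi>' z\<close> and \<open>\<psi>' x\<close> on \<open>u - z\<close> is then rewritten by
  the three-point identity for Bregman divergences.\<close>

lemma mirror_step_three_point:
  assumes prox: "prox_function \<sigma> Q \<psi> \<psi>'"
    and arg: "is_arg_min (\<lambda>y. blinfun_apply g y + 1 / \<gamma> * bregman \<psi> \<psi>' y x) (\<lambda>y. y \<in> Q) z"
    and u: "u \<in> Q"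
  shows "blinfun_apply g (z - u)
    \<le> (bregman \<psi> \<psi>' u x - bregman \<psi> \<psi>' u z - bregman \<psi> \<psi>' z x) / \<gamma>"
proof -
  let ?\<phi> = "\<lambda>y. blinfun_apply g y + 1 / \<gamma> * bregman \<psi> \<psi>' y x"
  have z: "z \<in> Q" and le: "\<And>y. y \<in> Q \<Longrightarrow> ?\<phi> z \<le> ?\<phi> y"
    using arg by (auto simp: is_arg_min_linorder)
  have cvx: "convex Q" and der: "(\<psi> has_derivative blinfun_apply (\<psi>' z)) (at z within Q)"
    using prox z by (auto simp: prox_function_def strongly_convex_on_def)
  let ?D = "\<lambda>h. - (blinfun_apply g h + 1 / \<gamma> * (blinfun_apply (\<psi>' z) h - blinfun_apply (\<psi>' x) h))"
  \<comment> \<open>The sign is flipped because minimality bounds increments from below, whereas the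
    derivative lemma wants an upper bound.\<close>
  have "((\<lambda>y. - ?\<phi> y) has_derivative ?D) (at z within Q)"
    unfolding bregman_def
    by (rule derivative_eq_intros der refl | simp add: blinfun.diff_right)+
  then have "?D (u - z) \<le> 0"
  proof (rule has_derivative_within_convex_le[where B = 0])
    fix t :: real assume "0 < t" "t < 1"
    then have "(1 - t) *\<^sub>R z + t *\<^sub>R u \<in> Q"
      using cvx u z by (intro convexD) auto
    then have "z + t *\<^sub>R (u - z) \<in> Q" by (simp add: algebra_simps)
    from le[OF this] show "- ?\<phi> (z + t *\<^sub>R (u - z)) - - ?\<phi> z \<le> t * (0 + 0 * t)"
      by simp
  qed (use cvx u z in auto)
  moreover have "bregman \<psi> \<psi>' u x - bregman \<psi> \<psi>' u z - bregman \<psi> \<psi>' z x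
      = blinfun_apply (\<psi>' z) (u - z) - blinfun_apply (\<psi>' x) (u - z)"
    by (simp add: bregman_def blinfun.diff_right)
  ultimately show ?thesis
    by (simp add: blinfun.diff_right)
qed

text \<open>The subgradient inequality is split at the new point \<open>z\<close>. The part from
  \<open>z\<close> to \<open>u\<close> is the three-point inequality; the part from \<open>x\<close>
  to \<open>z\<close> is bounded by Young's inequality, whose quadratic term is absorbed by
  \<open>bregman \<psi> \<psi>' z x / \<gamma>\<close> through \<open>bregman_ge\<close>.\<close>

lemma mirror_step_bound:
  assumes prox: "prox_function \<sigma> Q \<psi> \<psi>'"
    and arg: "is_arg_min (\<lambda>y. blinfun_apply g y + 1 / \<gamma> * bregman \<psi> \<psi>' y x) (\<lambda>y. y \<in> Q) z"
    and sub: "g \<in> subdifferential Q f x"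
    and mem: "x \<in> Q" "u \<in> Q" and \<gamma>: "\<gamma> > 0"
  shows "f x - f u
    \<le> \<gamma> * (norm g)\<^sup>2 / (2 * \<sigma>) + (bregman \<psi> \<psi>' u x - bregman \<psi> \<psi>' u z) / \<gamma>"
proof -
  let ?n = "norm (z - x)"
  have z: "z \<in> Q" and \<sigma>: "\<sigma> > 0"
    using arg prox by (auto simp: is_arg_min_def prox_function_def)
  have "f u \<ge> f x + blinfun_apply g (u - x)"
    using sub mem by (auto simp: subdifferential_def)
  then have "f x - f u \<le> blinfun_apply g (x - z) + blinfun_apply g (z - u)"
    by (simp add: blinfun.diff_right)
  also have "blinfun_apply g (x - z) \<le> norm g * ?n"
    using norm_blinfun[of g "x - z"] by (simp add: norm_minus_commute)
  also have "blinfun_apply g (z - u)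
      \<le> (bregman \<psi> \<psi>' u x - bregman \<psi> \<psi>' u z) / \<gamma> - bregman \<psi> \<psi>' z x / \<gamma>"
    using mirror_step_three_point[OF prox arg mem(2)] by (simp add: diff_divide_distrib)
  also have "norm g * ?n \<le> \<gamma> * (norm g)\<^sup>2 / (2 * \<sigma>) + (\<sigma> / 2 * ?n\<^sup>2) / \<gamma>"
  proof -
    have "0 \<le> (\<gamma> * norm g - \<sigma> * ?n)\<^sup>2 / (2 * \<sigma> * \<gamma>)"
      using \<sigma> \<gamma> by simp
    also have "\<dots> = \<gamma> * (norm g)\<^sup>2 / (2 * \<sigma>) + (\<sigma> / 2 * ?n\<^sup>2) / \<gamma> - norm g * ?n"
      using \<sigma> \<gamma> by (simp add: field_simps power2_eq_square)
    finally show ?thesis by simp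
  qed
  finally show ?thesis
    using bregman_ge[OF prox mem(1) z] \<gamma> divide_right_mono[of "\<sigma> / 2 * ?n\<^sup>2" "bregman \<psi> \<psi>' z x" \<gamma>]
    by simp
qed

text \<open>Summation by parts: each \<open>V k\<close> with \<open>k > 1\<close> appears with the
  nonnegative coefficient \<open>b k - b (k - 1)\<close>, so it may be replaced by \<open>R\<close>,
  and the coefficients then add up to \<open>b n\<close>. Keeping \<open>b n * V (Suc n)\<close> on
  the left makes the induction close.\<close>

lemma weighted_telescope_le:
  fixes b V :: "nat \<Rightarrow> real"
  assumes "1 \<le> n"
    and "\<And>k. 1 \<le> k \<Longrightarrow> k < n \<Longrightarrow> b k \<le> b (Suc k)"
    and "\<And>k. 1 \<le> k \<Longrightarrow> k \<le> n \<Longrightarrow> V k \<le> R"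
    and "0 \<le> b 1"
  shows "(\<Sum>k=1..n. b k * (V k - V (Suc k))) + b n * V (Suc n) \<le> b n * R"
  using assms
proof (induction n rule: dec_induct)
  case base
  then show ?case using mult_left_mono[of "V 1" R "b 1"] by (simp add: algebra_simps)
next
  case (step n)
  have "(b (Suc n) - b n) * V (Suc n) \<le> (b (Suc n) - b n) * R"
    using step.prems step.hyps by (intro mult_left_mono) auto
  moreover have "(\<Sum>k=1..n. b k * (V k - V (Suc k))) + b n * V (Suc n) \<le> b n * R"
    using step.prems by (intro step.IH) auto
  ultimately show ?case by (simp add: algebra_simps)
qed

section \<open>Finiteness, growth and bounds of the normalizers \<open>md_G\<close>\<close>

lemma md_G_Suc_real:
  "md_G a g (Suc k) = ereal (real_of_ereal (md_G a g (Suc k)))"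
proof (induction k)
  case (Suc k)
  obtain r where "md_G a g (Suc k) = ereal r" by (rule that[OF Suc.IH])
  then show ?case by (simp only: md_G.simps(2)[of a g "Suc k"]) (simp add: max_def)
qed simp

text \<open>The recursion in the reals starts at index 2, so that the infinite value at index 0
  never passes through \<open>real_of_ereal\<close>.\<close>

lemma real_md_G_Suc_Suc:
  "real_of_ereal (md_G a g (Suc (Suc k))) =
    max (real_of_ereal (md_G a g (Suc k))) (norm (g (Suc (Suc k))) * real (Suc (Suc k)) powr ((1 - a) / 2))"
proof -
  obtain r where "md_G a g (Suc k) = ereal r" by (rule that[OF md_G_Suc_real])
  then show ?thesis by (simp only: md_G.simps(2)[of a g "Suc k"]) (simp add: max_def)
qed

lemma md_G_ge:
  assumes "1 \<le> k"
  shows "norm (g k) * real k powr ((1 - a) / 2) \<le> real_of_ereal (md_G a g k)"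
proof -
  obtain j where j: "k = Suc j" using assms by (cases k) auto
  show ?thesis
  proof (cases j)
    case (Suc i)
    then show ?thesis unfolding j by (simp only: real_md_G_Suc_Suc max.cobounded2)
  qed (simp add: j)
qed

lemma md_G_mono:
  assumes "1 \<le> k"
  shows "real_of_ereal (md_G a g k) \<le> real_of_ereal (md_G a g (Suc k))"
proof -
  obtain j where "k = Suc j" using assms by (cases k) auto
  then show ?thesis by (simp only: real_md_G_Suc_Suc max.cobounded1)
qed

text \<open>As \<open>a \<le> 1\<close>, the power of the index is nondecreasing, so the last index
  dominates all terms of the running maximum.\<close>

lemma md_G_le:
  assumes "a \<le> 1" "1 \<le> k" "\<And>j. 1 \<le> j \<Longrightarrow> j \<le> k \<Longrightarrow> norm (g j) \<le> M"
  shows "real_of_ereal (md_G a g k) \<le> M * real k powr ((1 - a) / 2)"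
  using assms(2,3)
proof (induction k rule: dec_induct)
  case base
  then show ?case by simp
next
  case (step k)
  obtain j where j: "k = Suc j" using step.hyps by (cases k) auto
  have "0 \<le> M" using order_trans[OF norm_ge_zero step.prems[of 1]] by simp
  have "real_of_ereal (md_G a g k) \<le> M * real k powr ((1 - a) / 2)"
    using step.prems by (intro step.IH) auto
  also have "\<dots> \<le> M * real (Suc k) powr ((1 - a) / 2)"
    using \<open>0 \<le> M\<close> assms(1) by (intro mult_left_mono powr_mono2) auto
  finally have "real_of_ereal (md_G a g k) \<le> M * real (Suc k) powr ((1 - a) / 2)" .
  moreover have "norm (g (Suc k)) * real (Suc k) powr ((1 - a) / 2) \<le> M * real (Suc k) powr ((1 - a) / 2)"
    using step.prems[of "Suc k"] by (intro mult_right_mono) auto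
  ultimately show ?case
    unfolding j by (simp only: real_md_G_Suc_Suc max.bounded_iff)
qed

section \<open>Monotonicity and two-sided control of the weights\<close>

lemma md_weight_mult_mono:
  assumes "-1 \<le> m" "0 < c" "0 < H k" "H k \<le> H (Suc k)" "1 \<le> k"
  shows "md_weight m (\<lambda>k. c / H k) k * H k
    \<le> md_weight m (\<lambda>k. c / H k) (Suc k) * H (Suc k)"
proof (cases "m \<le> 0")
  case True
  \<comment> \<open>The extra factor \<open>H j\<close> raises the exponent from \<open>m\<close> to
    \<open>m + 1\<close>, which is nonnegative because \<open>-1 \<le> m\<close>.\<close>
  have eq: "md_weight m (\<lambda>k. c / H k) j * H j = H j powr (m + 1) / c powr m" if "0 < H j" for j
    using that assms True by (simp add: md_weight_def powr_divide powr_add)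
  show ?thesis
    using assms by (auto simp: eq intro!: divide_right_mono powr_mono2)
next
  case False
  then show ?thesis
    using assms by (auto simp: md_weight_def intro!: mult_mono powr_mono2)
qed

lemma md_weight_bounds:
  fixes H :: "nat \<Rightarrow> real"
  assumes "-1 \<le> m" "0 < c" "0 < M"
    and H: "\<forall>k\<in>K. 1 \<le> k \<and> 0 < H k \<and> H k \<le> M * sqrt (real k)"
  obtains p where "0 < p"
    "\<forall>k\<in>K. p * real k powr (m / 2) \<le> md_weight m (\<lambda>k. c / H k) k"
    "\<forall>k\<in>K. md_weight m (\<lambda>k. c / H k) k * H k \<le> p * M * real k powr ((m + 1) / 2)"
proof (cases "m \<le> 0")
  case True
  show ?thesis
  \<comment> \<open>This \<open>p\<close> is read off from the extreme case
    \<open>H k = M * sqrt k\<close>, where the weight is exactly \<open>p * k powr (m / 2)\<close>.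
    The upper bound on \<open>H k\<close> yields both claims: it reverses under the exponent
    \<open>m \<le> 0\<close> and is kept under \<open>m + 1 \<ge> 0\<close>.\<close>
  proof (rule that[of "M powr m / c powr m"]; (intro ballI)?)
    fix k assume "k \<in> K"
    with H have k: "1 \<le> k" "0 < H k" "H k \<le> M * sqrt (real k)" by auto
    have w: "md_weight m (\<lambda>k. c / H k) k = H k powr m / c powr m"
      using k assms True by (simp add: md_weight_def powr_divide)
    have s: "(M * sqrt (real k)) powr q = M powr q * real k powr (q / 2)" for q
      using k assms by (simp add: powr_mult powr_half_sqrt[symmetric] powr_powr)
    have "(M * sqrt (real k)) powr m \<le> H k powr m"
      using k True by (intro powr_mono2') auto
    then show "M powr m / c powr m * real k powr (m / 2) \<le> md_weight m (\<lambda>k. c / H k) k"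
      unfolding w s using divide_right_mono[of _ _ "c powr m"] by simp
    have "H k powr (m + 1) \<le> (M * sqrt (real k)) powr (m + 1)"
      using k assms by (intro powr_mono2) auto
    then have "H k powr (m + 1) / c powr m
        \<le> M powr (m + 1) * real k powr ((m + 1) / 2) / c powr m"
      unfolding s by (intro divide_right_mono) auto
    then show "md_weight m (\<lambda>k. c / H k) k * H k
        \<le> M powr m / c powr m * M * real k powr ((m + 1) / 2)"
      unfolding w using k assms by (simp add: powr_add mult_ac)
  qed (use assms in simp)
next
  case False
  show ?thesis
  proof (rule that[of 1]; (intro ballI)?)
    fix k assume "k \<in> K"
    with H have k: "1 \<le> k" "0 < H k" "H k \<le> M * sqrt (real k)" by auto
    show "1 * real k powr (m / 2) \<le> md_weight m (\<lambda>k. c / H k) k"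
      using False by (simp add: md_weight_def)
    have "real k powr (m / 2) * H k \<le> real k powr (m / 2) * (M * sqrt (real k))"
      using k by (intro mult_left_mono) auto
    also have "\<dots> = M * real k powr ((m + 1) / 2)"
      using k by (simp add: powr_half_sqrt[symmetric] add_divide_distrib powr_add)
    finally show "md_weight m (\<lambda>k. c / H k) k * H k \<le> 1 * M * real k powr ((m + 1) / 2)"
      using False by (simp add: md_weight_def)
  qed simp
qed

section \<open>Weighted summation over the iterates and Jensen's inequality\<close>

theorem theorem1:
  fixes B :: "'a::real_normed_vector set"
    and Q :: "'a set"
    and \<psi> f :: "'a \<Rightarrow> real"
    and \<psi>' :: "'a \<Rightarrow> 'a \<Rightarrow>\<^sub>L real"
    and \<sigma> R a m :: real
    and N :: nat
    and xstar xhat :: 'a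
    and x :: "nat \<Rightarrow> 'a"
    and g :: "nat \<Rightarrow> 'a \<Rightarrow>\<^sub>L real"
    and \<gamma> \<omega> :: "nat \<Rightarrow> real"
  assumes "finite_dimensional_vector_space ((*\<^sub>R) :: real \<Rightarrow> 'a \<Rightarrow> 'a) B"
    and "compact Q" and "convex Q"
    and "prox_function \<sigma> Q \<psi> \<psi>'"
    and "convex_on Q f" and "continuous_on Q f"
    and "xstar \<in> Q" and "\<forall>y\<in>Q. f xstar \<le> f y"
    and "R > 0" and "\<forall>y\<in>Q. bregman \<psi> \<psi>' xstar y \<le> R"
    and "0 \<le> a" and "a \<le> 1" and "m \<ge> -1" and "N \<ge> 1"
    and "\<forall>k\<in>{1..N}. g k \<in> subdifferential Q f (x k)"
    and "\<forall>k\<in>{1..N}. md_G a g k > 0"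
    and "\<forall>k\<in>{1..N}. \<gamma> k = md_step \<sigma> R a g k"
    and "x 1 \<in> Q"
    and "\<forall>k\<in>{1..N}.
           is_arg_min (\<lambda>y. blinfun_apply (g k) y + 1 / \<gamma> k * bregman \<psi> \<psi>' y (x k))
             (\<lambda>y. y \<in> Q) (x (Suc k))"
    and "\<forall>k\<in>{1..N}. \<omega> k = md_weight m \<gamma> k"
    and "xhat = (1 / (\<Sum>k=1..N. \<omega> k)) *\<^sub>R (\<Sum>k=1..N. \<omega> k *\<^sub>R x k)"
  shows "f xhat - f xstar
           \<le> sqrt (R / (2 * \<sigma>))
             * ((real N powr ((m + 1) / 2) + (\<Sum>k=1..N. real k powr ((m - 1) / 2)))
                / (\<Sum>k=1..N. real k powr (m / 2)))
             * (MAX k\<in>{1..N}. norm (g k))"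
proof -
  note prox = assms(4) and R = \<open>R > 0\<close> and N = \<open>N \<ge> 1\<close> and a = \<open>0 \<le> a\<close> \<open>a \<le> 1\<close>
  have \<sigma>: "\<sigma> > 0" using prox by (simp add: prox_function_def)
  define M where "M = (MAX k\<in>{1..N}. norm (g k))"
  define c where "c = sqrt (2 * \<sigma> * R)"
  define s where "s = sqrt (R / (2 * \<sigma>))"
  define H where "H k = real_of_ereal (md_G a g k) * real k powr (a / 2)" for k
  define V where "V k = bregman \<psi> \<psi>' xstar (x k)" for k
  have c: "c > 0" using \<sigma> R by (simp add: c_def)
  have s: "s > 0" using \<sigma> R by (simp add: s_def)
  \<comment> \<open>The constant in the step size balances the two error sources: the telescoped
    divergences contribute \<open>R / c\<close> and the subgradient norms
    \<open>c / (2 * \<sigma>)\<close>, and both equal \<open>s\<close>.\<close>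
  have "s * c = sqrt (R\<^sup>2)"
    using \<sigma> unfolding s_def c_def real_sqrt_mult[symmetric] by (simp add: power2_eq_square)
  moreover have "c * c = 2 * \<sigma> * R"
    using \<sigma> R by (simp add: c_def)
  ultimately have "s * c = R" "c * c = (2 * \<sigma> * s) * c"
    using R by (simp_all add: mult.assoc)
  then have sc: "R / c = s" "c / (2 * \<sigma>) = s"
    using c \<sigma> unfolding mult_right_cancel[OF less_imp_neq[OF c, symmetric]]
    by (auto simp: divide_eq_eq)
  have gM: "norm (g k) \<le> M" if "k \<in> {1..N}" for k
    using that unfolding M_def by (intro Max_ge) auto
  have Hpos: "H k > 0" if k: "k \<in> {1..N}" for k
  proof -
    obtain j where j: "k = Suc j" using k by (cases k) auto
    have "ereal 0 < ereal (real_of_ereal (md_G a g k))"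
      unfolding zero_ereal_def[symmetric] j md_G_Suc_real[symmetric]
      using assms(16) k[unfolded j] by blast
    then show ?thesis using k by (simp add: H_def)
  qed
  have Hmono: "H k \<le> H (Suc k)" if "1 \<le> k" "k < N" for k
    unfolding H_def using that a Hpos[of "Suc k"]
    by (intro mult_mono md_G_mono powr_mono2) (auto simp: H_def zero_less_mult_iff)
  \<comment> \<open>Here \<open>a\<close> drops out: the powers in \<open>md_G\<close> and in the
    step size combine to \<open>sqrt k\<close>.\<close>
  have sqrtk: "real k powr ((1 - a) / 2) * real k powr (a / 2) = sqrt (real k)" if "1 \<le> k" for k
    using that by (simp add: powr_add[symmetric] powr_half_sqrt[symmetric] diff_divide_distrib)
  have Hge: "norm (g k) * sqrt (real k) \<le> H k" if "k \<in> {1..N}" for k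
    using mult_right_mono[OF md_G_ge[of k g a], of "real k powr (a / 2)"] sqrtk[of k] that
    by (simp add: H_def mult.assoc)
  have Hle: "H k \<le> M * sqrt (real k)" if "k \<in> {1..N}" for k
    using mult_right_mono[OF md_G_le[of a k g M], of "real k powr (a / 2)"] sqrtk[of k] that a gM
    by (simp add: H_def mult.assoc)
  have M: "M > 0"
    using Hpos[of 1] Hle[of 1] N by simp
  have \<gamma>: "\<gamma> k = c / H k" if "k \<in> {1..N}" for k
    using assms(17) that by (simp add: md_step_def c_def H_def)
  have \<omega>: "\<omega> k = md_weight m (\<lambda>k. c / H k) k" if "k \<in> {1..N}" for k
    using assms(20) \<gamma> that by (simp add: md_weight_def)
  obtain p where p: "0 < p"
    and weight_ge: "\<forall>k\<in>{1..N}. p * real k powr (m / 2) \<le> md_weight m (\<lambda>k. c / H k) k"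
    and weight_le: "\<forall>k\<in>{1..N}. md_weight m (\<lambda>k. c / H k) k * H k
      \<le> p * M * real k powr ((m + 1) / 2)"
    using md_weight_bounds[OF \<open>m \<ge> -1\<close> c M, of "{1..N}" H] Hpos Hle by auto
  have \<omega>_ge: "p * real k powr (m / 2) \<le> \<omega> k" if "k \<in> {1..N}" for k
    using weight_ge \<omega> that by simp
  have \<omega>H_le: "\<omega> k * H k \<le> p * M * real k powr ((m + 1) / 2)" if "k \<in> {1..N}" for k
    using weight_le \<omega> that by simp
  have \<omega>_pos: "\<omega> k > 0" if "k \<in> {1..N}" for k
    using that p by (intro less_le_trans[OF _ \<omega>_ge[OF that]] mult_pos_pos) auto
  have \<omega>H_mono: "\<omega> k * H k \<le> \<omega> (Suc k) * H (Suc k)" if "1 \<le> k" "k < N" for k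
    using md_weight_mult_mono[of m c H k] that \<open>m \<ge> -1\<close> c Hpos[of k] Hmono[of k] \<omega>[of k] \<omega>[of "Suc k"]
    by simp
  have xQ_Suc: "x (Suc k) \<in> Q" if "k \<in> {1..N}" for k
    using assms(19) that by (auto simp: is_arg_min_def)
  \<comment> \<open>The range includes \<open>Suc N\<close>, since the telescoped sum ends with
    \<open>V (Suc N)\<close>.\<close>
  have xQ: "x k \<in> Q" if k: "k \<in> {1..Suc N}" for k
  proof (cases "k = 1")
    case False
    then obtain j where "k = Suc j" "j \<in> {1..N}" using k by (cases k) auto
    then show ?thesis using xQ_Suc by simp
  qed (use \<open>x 1 \<in> Q\<close> in simp)
  have step: "\<omega> k * (f (x k) - f xstar)
      \<le> s * (p * M * real k powr ((m - 1) / 2)) + \<omega> k * H k / c * (V k - V (Suc k))"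
    if k: "k \<in> {1..N}" for k
  proof -
    \<comment> \<open>This trades the squared subgradient norm over \<open>H k\<close> for
      \<open>H k / k\<close>, so that the bound on \<open>\<omega> k * H k\<close> also controls the
      error term.\<close>
    have gH: "(norm (g k))\<^sup>2 * real k \<le> (H k)\<^sup>2"
      using power_mono[OF Hge[OF k], of 2] by (simp add: power_mult_distrib)
    have "f (x k) - f xstar \<le> \<gamma> k * (norm (g k))\<^sup>2 / (2 * \<sigma>) + (V k - V (Suc k)) / \<gamma> k"
      unfolding V_def
    proof (rule mirror_step_bound[OF prox])
      show "0 < \<gamma> k" using \<gamma>[OF k] c Hpos[OF k] by simp
    qed (use assms k xQ in auto)
    also have "\<dots> = s * ((norm (g k))\<^sup>2 / H k) + H k / c * (V k - V (Suc k))"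
      by (simp add: \<gamma>[OF k] sc(2)[symmetric] mult_ac)
    also have "(norm (g k))\<^sup>2 / H k \<le> H k / real k"
      using gH k Hpos[OF k] by (simp add: field_simps power2_eq_square)
    finally have "f (x k) - f xstar \<le> s * (H k / real k) + H k / c * (V k - V (Suc k))"
      using s by simp
    from mult_left_mono[OF this, of "\<omega> k"]
    have "\<omega> k * (f (x k) - f xstar)
        \<le> s * (\<omega> k * H k / real k) + \<omega> k * H k / c * (V k - V (Suc k))"
      using \<omega>_pos[OF k] by (simp add: algebra_simps diff_divide_distrib)
    moreover have "\<omega> k * H k / real k \<le> p * M * real k powr ((m - 1) / 2)"
    proof -
      have "real k powr ((m + 1) / 2) / real k = real k powr ((m - 1) / 2)"
        using k powr_diff[of "real k" "(m + 1) / 2" 1] by (simp add: field_simps)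
      then show ?thesis
        using divide_right_mono[OF \<omega>H_le[OF k], of "real k"]
        by (simp flip: times_divide_eq_right)
    qed
    then have "s * (\<omega> k * H k / real k) \<le> s * (p * M * real k powr ((m - 1) / 2))"
      using s by (intro mult_left_mono) auto
    ultimately show ?thesis by linarith
  qed
  \<comment> \<open>The coefficients are \<open>\<omega> k / \<gamma> k\<close>, nondecreasing by
    \<open>\<omega>H_mono\<close>; the leftover \<open>V (Suc N)\<close> is nonnegative and can be
    discarded.\<close>
  have tele: "(\<Sum>k=1..N. \<omega> k * H k / c * (V k - V (Suc k))) \<le> s * (p * M * real N powr ((m + 1) / 2))"
  proof -
    have "(\<Sum>k=1..N. \<omega> k * H k / c * (V k - V (Suc k))) + \<omega> N * H N / c * V (Suc N)
        \<le> \<omega> N * H N / c * R"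
    proof (rule weighted_telescope_le[OF N])
      show "V k \<le> R" if "1 \<le> k" "k \<le> N" for k
        using that assms(10) xQ[of k] by (simp add: V_def)
      show "\<omega> k * H k / c \<le> \<omega> (Suc k) * H (Suc k) / c" if "1 \<le> k" "k < N" for k
        using \<omega>H_mono[OF that] c by (simp add: divide_right_mono)
      show "0 \<le> \<omega> 1 * H 1 / c"
        using \<omega>_pos[of 1] Hpos[of 1] c N by simp
    qed
    moreover have "0 \<le> V (Suc N)"
    proof -
      have "0 \<le> \<sigma> / 2 * (norm (xstar - x (Suc N)))\<^sup>2" using \<sigma> by simp
      also have "\<dots> \<le> V (Suc N)"
        unfolding V_def using bregman_ge[OF prox] xQ assms(7) by simp
      finally show ?thesis .
    qed
    then have "0 \<le> \<omega> N * H N / c * V (Suc N)"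
      using \<omega>_pos[of N] Hpos[of N] c N by simp
    moreover have "\<omega> N * H N / c * R = s * (\<omega> N * H N)"
      by (simp add: sc(1)[symmetric])
    moreover have "s * (\<omega> N * H N) \<le> s * (p * M * real N powr ((m + 1) / 2))"
      using \<omega>H_le[of N] N s by (intro mult_left_mono) auto
    ultimately show ?thesis by linarith
  qed
  let ?W = "\<Sum>k=1..N. \<omega> k"
  let ?K = "real N powr ((m + 1) / 2) + (\<Sum>k=1..N. real k powr ((m - 1) / 2))"
  let ?S = "\<Sum>k=1..N. real k powr (m / 2)"
  have S: "?S > 0" using N by (intro sum_pos) auto
  have W: "?W > 0" using N \<omega>_pos by (intro sum_pos) auto
  have WS: "p * ?S \<le> ?W"
    unfolding sum_distrib_left by (intro sum_mono \<omega>_ge)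
  have K: "?K \<ge> 0" by (intro add_nonneg_nonneg sum_nonneg) auto
  have "(\<Sum>k=1..N. \<omega> k * (f (x k) - f xstar))
      \<le> (\<Sum>k=1..N. s * (p * M * real k powr ((m - 1) / 2)) + \<omega> k * H k / c * (V k - V (Suc k)))"
    by (intro sum_mono step)
  also have "\<dots> \<le> s * p * M * ?K"
    using tele by (simp add: sum.distrib sum_distrib_left algebra_simps)
  finally have total: "(\<Sum>k=1..N. \<omega> k * (f (x k) - f xstar)) \<le> s * p * M * ?K" .
  have "xhat = (\<Sum>k=1..N. (\<omega> k / ?W) *\<^sub>R x k)"
    using assms(21) by (simp add: scaleR_sum_right)
  moreover have "f (\<Sum>k=1..N. (\<omega> k / ?W) *\<^sub>R x k) \<le> (\<Sum>k=1..N. \<omega> k / ?W * f (x k))"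
  proof (rule convex_on_sum[OF _ _ \<open>convex_on Q f\<close>])
    show "(\<Sum>k=1..N. \<omega> k / ?W) = 1"
      using W by (simp add: sum_divide_distrib[symmetric])
    show "0 \<le> \<omega> k / ?W" if "k \<in> {1..N}" for k
      using \<omega>_pos[OF that] W by simp
  qed (use N xQ in auto)
  moreover have "(\<Sum>k=1..N. \<omega> k / ?W * f (x k)) - f xstar
      = (\<Sum>k=1..N. \<omega> k * (f (x k) - f xstar)) / ?W"
    using W by (simp add: right_diff_distrib sum_subtractf sum_divide_distrib[symmetric]
        sum_distrib_right[symmetric] diff_divide_distrib)
  ultimately have "f xhat - f xstar \<le> (\<Sum>k=1..N. \<omega> k * (f (x k) - f xstar)) / ?W"
    by simp
  also have "\<dots> \<le> s * p * M * ?K / ?W"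
    using total W by (intro divide_right_mono) auto
  \<comment> \<open>The numerator is nonnegative, so the lower bound \<open>p * ?S\<close> may
    replace the total weight; then \<open>p\<close> cancels.\<close>
  also have "\<dots> \<le> s * p * M * ?K / (p * ?S)"
    using WS W S K p s M by (intro divide_left_mono mult_nonneg_nonneg mult_pos_pos) auto
  also have "\<dots> = s * (?K / ?S) * M"
    using p by simp
  finally show ?thesis by (simp only: s_def M_def)
qed

end
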